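(* Let $(X,d,\ll,\leq,\tau)$ be an intrinsic Lorentzian pre-length space, $\Omega\colon X\to(0,+\infty)$ a continuous function, and let $x,y\in X$ be any two points. Then $$\tau_\Omega(x,y)>0\iff\tau(x,y)>0,$$ and $$\big(x\leq_\Omega y\ \text{and}\ x\not\ll_\Omega y\big)\iff\big(x\leq y\ \text{and}\ x\not\ll y\big).$$
   Context: A Lorentzian pre-length space $(X,d,\ll,\leq,\tau)$ consists of a set $X$, a metric $d$ on $X$, two transitive relations $\ll,\leq$ on $X$ with $\leq$ reflexive and $\ll$ contained in $\leq$, and a map $\tau\colon X\times X\to[0,+\infty]$ which is lower semicontinuous with respect to the topology of $d$, satisfies $\tau(x,z)\geq\tau(x,y)+\tau(y,z)$ whenever $x\leq y\leq z$, satisfies $\tau(x,y)=0$ if $x\not\leq y$, and satisfies $\tau(x,y)>0$ if and only if $x\ll y$. A curve is a continuous map from an interval into $X$. A non-constant curve $\gamma\colon I\to X$ is causal if $\gamma(t)\leq\gamma(s)$ for all $t<s$ in $I$. A causal curve from $x$ to $y$ is one defined on a compact interval, starting at $x$ and ending at $y$. For a causal curve $\gamma\colon[a,b]\to X$ put $$L_\Omega^\tau(\gamma):=\inf\Big\{\sum_{i=0}^{m-1}\max_{t\in[t_i,t_{i+1}]}\Omega(\gamma(t))\,\tau(\gamma(t_i),\gamma(t_{i+1}))\ :\ a=t_0<\dots<t_m=b\Big\},$$ and let $L^\tau(\gamma)$ be the same quantity with $\Omega\equiv1$. Define $$\tau_\Omega(x,y):=\sup\big(\{0\}\cup\{L_\Omega^\tau(\gamma):\gamma\text{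 a causal curve from }x\text{ to }y\}\big),$$ $x\ll_\Omega y:\iff\tau_\Omega(x,y)>0$, and $x\leq_\Omega y:\iff x\leq y$. The space is intrinsic if $\tau(x,y)=\sup(\{0\}\cup\{L^\tau(\gamma):\gamma\text{ a causal curve from }x\text{ to }y\})$ for all $x,y\in X$. *)

theory Defs
  imports "HOL-Analysis.Analysis"
begin

text \<open>
  The space X is a type of class \<^class>\<open>metric_space\<close>; the metric d is \<^const>\<open>dist\<close>.
  The relation \<open>ll\<close> is the chronological, \<open>le\<close> the causal relation.
\<close>

locale lorentzian_pre_length_space =
  fixes ll le :: "'a::metric_space \<Rightarrow> 'a \<Rightarrow> bool"
    and \<tau> :: "'a \<Rightarrow> 'a \<Rightarrow> ennreal"
  assumes ll_trans: "transp ll"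
    and le_trans: "transp le"
    and le_refl: "reflp le"
    and ll_imp_le: "ll x y \<Longrightarrow> le x y"
    \<comment> \<open>lower semicontinuity on X \<open>\<times>\<close> X\<close>
    and tau_lsc: "open {(x, y). c < \<tau> x y}"
    and reverse_triangle: "le x y \<Longrightarrow> le y z \<Longrightarrow> \<tau> x y + \<tau> y z \<le> \<tau> x z"
    and tau_eq_0: "\<not> le x y \<Longrightarrow> \<tau> x y = 0"
    and tau_pos_iff: "0 < \<tau> x y \<longleftrightarrow> ll x y"

text \<open>A causal curve defined on the compact interval from \<open>a\<close> to \<open>b\<close>; the values of
  \<open>\<gamma>\<close> outside that interval are irrelevant. Being non-constant forces \<open>a < b\<close>.\<close>

definition causal_curve ::
  "('a::metric_space \<Rightarrow> 'a \<Rightarrow> bool) \<Rightarrow> (real \<Rightarrow> 'a) \<Rightarrow> real \<Rightarrow> real \<Rightarrow> bool" where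
  "causal_curve le \<gamma> a b \<longleftrightarrow>
     a \<le> b \<and> continuous_on {a..b} \<gamma> \<and> \<not> \<gamma> constant_on {a..b} \<and>
     (\<forall>t\<in>{a..b}. \<forall>s\<in>{a..b}. t < s \<longrightarrow> le (\<gamma> t) (\<gamma> s))"

definition causal_curve_from_to ::
  "('a::metric_space \<Rightarrow> 'a \<Rightarrow> bool) \<Rightarrow> 'a \<Rightarrow> 'a \<Rightarrow> (real \<Rightarrow> 'a) \<Rightarrow> real \<Rightarrow> real \<Rightarrow> bool" where
  "causal_curve_from_to le x y \<gamma> a b \<longleftrightarrow> causal_curve le \<gamma> a b \<and> \<gamma> a = x \<and> \<gamma> b = y"

definition is_partition :: "real \<Rightarrow> real \<Rightarrow> nat \<Rightarrow> (nat \<Rightarrow> real) \<Rightarrow> bool" where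
  "is_partition a b m t \<longleftrightarrow> t 0 = a \<and> t m = b \<and> (\<forall>i<m. t i < t (Suc i))"

text \<open>The maximum over a compact parameter interval is written as a supremum; for continuous
  \<open>\<Omega>\<close> and \<open>\<gamma>\<close> it is attained.\<close>

definition L_Omega ::
  "('a \<Rightarrow> real) \<Rightarrow> ('a \<Rightarrow> 'a \<Rightarrow> ennreal) \<Rightarrow> (real \<Rightarrow> 'a) \<Rightarrow> real \<Rightarrow> real \<Rightarrow> ennreal" where
  "L_Omega \<Omega> \<tau> \<gamma> a b =
     Inf {(\<Sum>i<m. (SUP s\<in>{t i..t (Suc i)}. ennreal (\<Omega> (\<gamma> s))) * \<tau> (\<gamma> (t i)) (\<gamma> (t (Suc i)))) |
          m t. is_partition a b m t}"

definition L_tau ::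
  "('a \<Rightarrow> 'a \<Rightarrow> ennreal) \<Rightarrow> (real \<Rightarrow> 'a) \<Rightarrow> real \<Rightarrow> real \<Rightarrow> ennreal" where
  "L_tau \<tau> \<gamma> a b = L_Omega (\<lambda>_. 1) \<tau> \<gamma> a b"

definition tau_Omega ::
  "('a::metric_space \<Rightarrow> real) \<Rightarrow> ('a \<Rightarrow> 'a \<Rightarrow> bool) \<Rightarrow> ('a \<Rightarrow> 'a \<Rightarrow> ennreal) \<Rightarrow> 'a \<Rightarrow> 'a \<Rightarrow> ennreal" where
  "tau_Omega \<Omega> le \<tau> x y =
     Sup ({0} \<union> {L_Omega \<Omega> \<tau> \<gamma> a b | \<gamma> a b. causal_curve_from_to le x y \<gamma> a b})"

definition ll_Omega ::
  "('a::metric_space \<Rightarrow> real) \<Rightarrow> ('a \<Rightarrow> 'a \<Rightarrow> bool) \<Rightarrow> ('a \<Rightarrow> 'a \<Rightarrow> ennreal) \<Rightarrow> 'a \<Rightarrow> 'a \<Rightarrow> bool" where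
  "ll_Omega \<Omega> le \<tau> x y \<longleftrightarrow> 0 < tau_Omega \<Omega> le \<tau> x y"

definition le_Omega ::
  "('a::metric_space \<Rightarrow> real) \<Rightarrow> ('a \<Rightarrow> 'a \<Rightarrow> bool) \<Rightarrow> 'a \<Rightarrow> 'a \<Rightarrow> bool" where
  "le_Omega \<Omega> le x y \<longleftrightarrow> le x y"

definition intrinsic ::
  "('a::metric_space \<Rightarrow> 'a \<Rightarrow> bool) \<Rightarrow> ('a \<Rightarrow> 'a \<Rightarrow> ennreal) \<Rightarrow> bool" where
  "intrinsic le \<tau> \<longleftrightarrow>
     (\<forall>x y. \<tau> x y =
        Sup ({0} \<union> {L_tau \<tau> \<gamma> a b | \<gamma> a b. causal_curve_from_to le x y \<gamma> a b}))"

end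

theory Submission
  imports Defs
begin

text \<open>
  Length with respect to different continuous positive weights differs on a fixed causal curve only
  by a bounded factor: for weights \<open>\<Omega>\<close> and \<open>\<Psi>\<close> the quotient \<open>\<Psi> / \<Omega>\<close> is bounded
  below by some \<open>c > 0\<close> along the curve, since a curve over a compact interval has compact image,
  and this bound passes through every partition sum to the infimum
  (\<open>scaled_L_Omega_le\<close>). The factor \<open>c\<close> depends on the curve, so the two suprema over all curves
  need not be comparable. Positivity of a supremum, however, is witnessed by a single curve, and
  so does not depend on the weight (\<open>tau_Omega_pos_transfer\<close>). Being intrinsic
  says that \<open>\<tau>\<close> is the time separation for the weight \<open>1\<close>; comparing \<open>\<Omega>\<close> with \<open>1\<close> in both
  directions gives the first equivalence. The second one is the first rewritten in terms of the
  relations, as the causal relation is the same in both structures.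
\<close>

lemma is_partition_in_interval:
  assumes "is_partition a b m t" "i \<le> m"
  shows "t i \<in> {a..b}"
proof -
  have incr: "t j \<le> t (Suc j)" if "j < m" for j
    using assms(1) that by (auto simp: is_partition_def less_imp_le)
  have "t 0 \<le> t i"
    using assms(2)
  proof (induction i)
    case (Suc i)
    then show ?case using incr[of i] by simp
  qed simp
  moreover have "t i \<le> t m"
    using assms(2)
  proof (induction rule: inc_induct)
    case (step n)
    then show ?case using incr[of n] by simp
  qed simp
  ultimately show ?thesis
    using assms(1) by (simp add: is_partition_def)
qed

text \<open>
  The suprema in the partition sums run over pieces of the curve only, so a pointwise comparison of
  the weights along the curve suffices. The factor stands on the smaller side, so that the bound on
  all partition sums yields the claim directly, without moving a factor through an infimum.
\<close>

lemma scaled_L_Omega_le: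
  assumes c: "0 \<le> c"
    and le: "\<And>s. s \<in> {a..b} \<Longrightarrow> c * \<Omega> (\<gamma> s) \<le> \<Psi> (\<gamma> s)"
  shows "ennreal c * L_Omega \<Omega> \<tau> \<gamma> a b \<le> L_Omega \<Psi> \<tau> \<gamma> a b"
proof -
  have "ennreal c * L_Omega \<Omega> \<tau> \<gamma> a b
      \<le> (\<Sum>i<m. (SUP s\<in>{t i..t (Suc i)}. ennreal (\<Psi> (\<gamma> s))) * \<tau> (\<gamma> (t i)) (\<gamma> (t (Suc i))))"
    if part: "is_partition a b m t" for m t
  proof -
    have "L_Omega \<Omega> \<tau> \<gamma> a b
        \<le> (\<Sum>i<m. (SUP s\<in>{t i..t (Suc i)}. ennreal (\<Omega> (\<gamma> s))) * \<tau> (\<gamma> (t i)) (\<gamma> (t (Suc i))))"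
      unfolding L_Omega_def using part by (intro Inf_lower) auto
    then have "ennreal c * L_Omega \<Omega> \<tau> \<gamma> a b
        \<le> ennreal c *
          (\<Sum>i<m. (SUP s\<in>{t i..t (Suc i)}. ennreal (\<Omega> (\<gamma> s))) * \<tau> (\<gamma> (t i)) (\<gamma> (t (Suc i))))"
      by (intro mult_left_mono) auto
    also have "\<dots> = (\<Sum>i<m. (SUP s\<in>{t i..t (Suc i)}. ennreal c * ennreal (\<Omega> (\<gamma> s))) *
        \<tau> (\<gamma> (t i)) (\<gamma> (t (Suc i))))"
      by (simp only: sum_distrib_left SUP_mult_left_ennreal mult.assoc[symmetric])
    also have "\<dots> \<le> (\<Sum>i<m. (SUP s\<in>{t i..t (Suc i)}. ennreal (\<Psi> (\<gamma> s))) *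
        \<tau> (\<gamma> (t i)) (\<gamma> (t (Suc i))))"
    proof (intro sum_mono mult_right_mono SUP_subset_mono order_refl)
      fix i s
      assume "i \<in> {..<m}" "s \<in> {t i..t (Suc i)}"
      then have "s \<in> {a..b}"
        using is_partition_in_interval[OF part, of i] is_partition_in_interval[OF part, of "Suc i"]
        by auto
      then show "ennreal c * ennreal (\<Omega> (\<gamma> s)) \<le> ennreal (\<Psi> (\<gamma> s))"
        using c le by (simp add: ennreal_mult'[symmetric] ennreal_leI)
    qed auto
    finally show ?thesis .
  qed
  then show ?thesis
    unfolding L_Omega_def[of \<Psi>] by (intro Inf_greatest) auto
qed

lemma tau_Omega_pos_transfer:
  assumes cont: "continuous_on UNIV \<Omega>" "continuous_on UNIV \<Psi>"
    and pos: "\<And>z. 0 < \<Omega> z" "\<And>z. 0 < \<Psi> z"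
    and tau: "0 < tau_Omega \<Omega> le \<tau> x y"
  shows "0 < tau_Omega \<Psi> le \<tau> x y"
proof -
  obtain \<gamma> a b where curve: "causal_curve_from_to le x y \<gamma> a b"
    and length_pos: "0 < L_Omega \<Omega> \<tau> \<gamma> a b"
    using tau unfolding tau_Omega_def less_Sup_iff by auto
  then have "a \<le> b" and cont_\<gamma>: "continuous_on {a..b} \<gamma>"
    by (auto simp: causal_curve_from_to_def causal_curve_def)
  have "continuous_on {a..b} (\<lambda>s. \<Psi> (\<gamma> s) / \<Omega> (\<gamma> s))"
    using pos(1)
    by (intro continuous_on_divide continuous_on_compose2[OF cont(1) cont_\<gamma>]
        continuous_on_compose2[OF cont(2) cont_\<gamma>]) (auto simp: less_imp_neq[symmetric])
  then obtain s\<^sub>0 where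
    min: "\<And>s. s \<in> {a..b} \<Longrightarrow> \<Psi> (\<gamma> s\<^sub>0) / \<Omega> (\<gamma> s\<^sub>0) \<le> \<Psi> (\<gamma> s) / \<Omega> (\<gamma> s)"
    using continuous_attains_inf[of "{a..b}"] \<open>a \<le> b\<close> by fastforce
  define c where "c = \<Psi> (\<gamma> s\<^sub>0) / \<Omega> (\<gamma> s\<^sub>0)"
  have "0 < c"
    using pos by (simp add: c_def)
  have "c * \<Omega> (\<gamma> s) \<le> \<Psi> (\<gamma> s)" if "s \<in> {a..b}" for s
    using min[OF that] pos(1)[of "\<gamma> s"] by (simp add: c_def pos_le_divide_eq)
  then have "ennreal c * L_Omega \<Omega> \<tau> \<gamma> a b \<le> L_Omega \<Psi> \<tau> \<gamma> a b"
    using \<open>0 < c\<close> by (intro scaled_L_Omega_le) auto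
  moreover have "0 < ennreal c * L_Omega \<Omega> \<tau> \<gamma> a b"
    using \<open>0 < c\<close> length_pos by (simp add: ennreal_zero_less_mult_iff)
  ultimately have "0 < L_Omega \<Psi> \<tau> \<gamma> a b"
    by (rule less_le_trans[rotated])
  then show ?thesis
    using curve unfolding tau_Omega_def less_Sup_iff by auto
qed

theorem proposition3p7:
  fixes ll le :: "'a::metric_space \<Rightarrow> 'a \<Rightarrow> bool"
    and \<tau> :: "'a \<Rightarrow> 'a \<Rightarrow> ennreal"
    and \<Omega> :: "'a \<Rightarrow> real"
    and x y :: 'a
  assumes "lorentzian_pre_length_space ll le \<tau>"
    and "intrinsic le \<tau>"
    and "continuous_on UNIV \<Omega>"
    and "\<And>z. 0 < \<Omega> z"
  shows "(tau_Omega \<Omega> le \<tau> x y > 0 \<longleftrightarrow> \<tau> x y > 0) \<and>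
         ((le_Omega \<Omega> le x y \<and> \<not> ll_Omega \<Omega> le \<tau> x y) \<longleftrightarrow> (le x y \<and> \<not> ll x y))"
proof -
  have "\<tau> x y = tau_Omega (\<lambda>_. 1) le \<tau> x y"
    using assms(2) unfolding intrinsic_def tau_Omega_def L_tau_def by blast
  moreover have "0 < tau_Omega \<Omega> le \<tau> x y \<longleftrightarrow> 0 < tau_Omega (\<lambda>_. 1) le \<tau> x y"
    using tau_Omega_pos_transfer[of \<Omega> "\<lambda>_. 1"] tau_Omega_pos_transfer[of "\<lambda>_. 1" \<Omega>]
      assms(3,4) by auto
  ultimately have "0 < tau_Omega \<Omega> le \<tau> x y \<longleftrightarrow> 0 < \<tau> x y"
    by simp
  then show ?thesis
    using lorentzian_pre_length_space.tau_pos_iff[OF assms(1)]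
    by (simp add: le_Omega_def ll_Omega_def)
qed

end
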